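(* Let $T>0$, let $\mu:[0,T]\to[0,\infty)$ be an integrable function (the follower's feed message intensity due to other broadcasters), and let $k\ge1$ be an integer. Let $\mathcal H$ be the space of all smooth functions $[0,T]\to\mathbb R$, and for $\lambda\in\mathcal H$ (the broadcaster's message intensity) define $$ f_k(t)[\lambda]=\frac{1}{(k-1)!}\int_0^t \lambda(\tau)\, e^{-\int_\tau^t \lambda(x)\,dx}\;\Gamma\!\left[k,\int_\tau^t\mu(x)\,dx\right]d\tau \quad (t\in[0,T]),\qquad \mathcal V(k)[\lambda]=\int_0^T f_k(t)[\lambda]\,dt, $$ where $\Gamma[k,x]=\int_x^\infty s^{k-1}e^{-s}\,ds$. Then the average visibility functional $\lambda\mapsto\mathcal V(k)[\lambda]$ is concave on $\mathcal H$.
   Context: A functional $J:\mathcal H\to\mathbb R$ is concave if for all $g_1,g_2\in\mathcal H$ and all $0<\alpha<1$, $J[\alpha g_1+(1-\alpha)g_2]\ge \alpha J[g_1]+(1-\alpha)J[g_2]$. For nonnegative $\lambda$, $f_k(t)[\lambda]$ is the probability that at least one message from a broadcaster with message intensity $\lambda$ is among the $k$ most recent messages received at time $t$ by a follower whose feed intensity due to other broadcasters is $\mu$, and $\mathcal V(k)$ is the expected amount of time in $[0,T]$ during which this happens. *)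

theory Defs
  imports "HOL-Analysis.Analysis"
begin

text \<open>
  A function is smooth on \<open>{a..b}\<close> if it has derivatives of every order there, one-sided at the
  two endpoints; \<open>D n\<close> is the \<open>n\<close>-th derivative. Elements of \<open>smooth_space T\<close> are total functions
  on the reals whose values outside \<open>{0..T}\<close> are unconstrained; none of the definitions below
  look at these values.
\<close>

definition smooth_on_interval :: "real \<Rightarrow> real \<Rightarrow> (real \<Rightarrow> real) \<Rightarrow> bool" where
  "smooth_on_interval a b f \<longleftrightarrow>
     (\<exists>D :: nat \<Rightarrow> real \<Rightarrow> real.
        (\<forall>x\<in>{a..b}. D 0 x = f x) \<and>
        (\<forall>n. \<forall>x\<in>{a..b}. (D n has_real_derivative D (Suc n) x) (at x within {a..b})))"

definition smooth_space :: "real \<Rightarrow> (real \<Rightarrow> real) set" where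
  "smooth_space T = {f. smooth_on_interval 0 T f}"

definition upper_incomplete_Gamma :: "nat \<Rightarrow> real \<Rightarrow> real" where
  "upper_incomplete_Gamma k x = integral {x..} (\<lambda>s. s ^ (k - 1) * exp (- s))"

definition top_k_prob ::
  "(real \<Rightarrow> real) \<Rightarrow> nat \<Rightarrow> (real \<Rightarrow> real) \<Rightarrow> real \<Rightarrow> real" where
  "top_k_prob \<mu> k lam t =
     1 / fact (k - 1) *
     integral {0..t} (\<lambda>\<tau>. lam \<tau> * exp (- integral {\<tau>..t} lam) *
                          upper_incomplete_Gamma k (integral {\<tau>..t} \<mu>))"

definition visibility ::
  "(real \<Rightarrow> real) \<Rightarrow> real \<Rightarrow> nat \<Rightarrow> (real \<Rightarrow> real) \<Rightarrow> real" where
  "visibility \<mu> T k lam = integral {0..T} (top_k_prob \<mu> k lam)"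

text \<open>
  The library's \<^const>\<open>concave_on\<close> is not applicable, since function types are not an instance of
  class \<^class>\<open>real_vector\<close>; the convex combination of two functions is taken pointwise.
\<close>

definition concave_functional_on ::
  "(real \<Rightarrow> real) set \<Rightarrow> ((real \<Rightarrow> real) \<Rightarrow> real) \<Rightarrow> bool" where
  "concave_functional_on H J \<longleftrightarrow>
     (\<forall>g1\<in>H. \<forall>g2\<in>H. \<forall>\<alpha>. 0 < \<alpha> \<and> \<alpha> < 1 \<longrightarrow>
        J (\<lambda>x. \<alpha> * g1 x + (1 - \<alpha>) * g2 x) \<ge> \<alpha> * J g1 + (1 - \<alpha>) * J g2)"

end

theory Submission
  imports Defs
begin

text \<open>
  Put \<open>G \<tau> = \<Gamma>[k, \<integral>\<^sub>\<tau>\<^sup>t \<mu>]\<close>, which is nonnegative and nondecreasing in \<open>\<tau>\<close>. Since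
  \<open>\<lambda>(\<tau>) exp (- \<integral>\<^sub>\<tau>\<^sup>t \<lambda>)\<close> is the derivative of \<open>exp (- \<integral>\<^sub>\<tau>\<^sup>t \<lambda>)\<close> in \<open>\<tau>\<close>, its integral over a tail
  \<open>{c..t}\<close> is \<open>1 - exp (- \<integral>\<^sub>c\<^sup>t \<lambda>)\<close>, a concave function of \<open>\<lambda>\<close>. Hence the concavity defect of this
  kernel has nonnegative integral over every tail, and by the second mean value theorem it keeps
  a nonnegative integral after multiplication by \<open>G\<close>. This avoids differentiating \<open>G\<close>, which
  would be delicate for a merely integrable \<open>\<mu>\<close>.
\<close>

section \<open>Monotone weights and the exponential kernel\<close>

text \<open>The second mean value theorem trades \<open>G\<close> for a two-step function:
  \<open>G a\<close> on all of \<open>{a..b}\<close> plus the nonnegative jump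
  \<open>G b - G a\<close> on some tail \<open>{c..b}\<close>. Both pieces meet a tail integral of
  \<open>h\<close>.\<close>

lemma integral_mono_weight_nonneg:
  fixes h G :: "real \<Rightarrow> real"
  assumes h: "h integrable_on {a..b}" and "a \<le> b"
    and mono: "\<And>x y. \<lbrakk>a \<le> x; x \<le> y; y \<le> b\<rbrakk> \<Longrightarrow> G x \<le> G y"
    and "G a \<ge> 0"
    and tail: "\<And>c. c \<in> {a..b} \<Longrightarrow> integral {c..b} h \<ge> 0"
  shows "integral {a..b} (\<lambda>x. G x * h x) \<ge> 0"
proof -
  obtain c where c: "c \<in> {a..b}"
    and eq: "integral {a..b} (\<lambda>x. G x * h x) = G a * integral {a..c} h + G b * integral {c..b} h"
    using second_mean_value_theorem [where g = G, OF h \<open>a \<le> b\<close> mono] .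
  have "integral {a..c} h + integral {c..b} h = integral {a..b} h"
    using c h by (intro Henstock_Kurzweil_Integration.integral_combine) auto
  then have "integral {a..b} (\<lambda>x. G x * h x)
      = G a * integral {a..b} h + (G b - G a) * integral {c..b} h"
    unfolding eq by (simp add: algebra_simps flip: distrib_left)
  moreover have "G a * integral {a..b} h \<ge> 0"
    using \<open>G a \<ge> 0\<close> tail[of a] \<open>a \<le> b\<close> by simp
  moreover have "(G b - G a) * integral {c..b} h \<ge> 0"
    using mono[of a b] tail[OF c] \<open>a \<le> b\<close> by simp
  ultimately show ?thesis by simp
qed

lemma has_integral_exp_neg_tail:
  fixes g :: "real \<Rightarrow> real"
  assumes g: "continuous_on {c..t} g" and "c \<le> t"
  shows "((\<lambda>\<tau>. g \<tau> * exp (- integral {\<tau>..t} g)) has_integral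
           1 - exp (- integral {c..t} g)) {c..t}"
proof -
  have "((\<lambda>\<tau>. g \<tau> * exp (- integral {\<tau>..t} g)) has_integral
      exp (- integral {t..t} g) - exp (- integral {c..t} g)) {c..t}"
  proof (rule fundamental_theorem_of_calculus [OF \<open>c \<le> t\<close>])
    fix x assume "x \<in> {c..t}"
    then show "((\<lambda>\<tau>. exp (- integral {\<tau>..t} g)) has_vector_derivative
        g x * exp (- integral {x..t} g)) (at x within {c..t})"
      \<comment> \<open>Differentiating in the lower limit gives \<open>- g x\<close>, whose sign
        cancels the one in the exponent.\<close>
      unfolding has_real_derivative_iff_has_vector_derivative [symmetric]
      by (auto intro!: derivative_eq_intros integral_has_real_derivative' [OF g])
  qed
  then show ?thesis by simp
qed

section \<open>Continuity of integrals with variable limits\<close>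

text \<open>The substitution \<tau> = t * u moves the integral to the fixed interval
  \<open>{0..1}\<close>, where continuity in a parameter under the integral sign applies.\<close>

lemma continuous_on_integral_upto:
  fixes F :: "real \<Rightarrow> real \<Rightarrow> real"
  assumes F: "continuous_on {(t, \<tau>). 0 \<le> \<tau> \<and> \<tau> \<le> t \<and> t \<le> T} (\<lambda>(t, \<tau>). F t \<tau>)"
  shows "continuous_on {0..T} (\<lambda>t. integral {0..t} (F t))"
proof -
  have eq: "integral {0..t} (F t) = t * integral {0..1} (\<lambda>u. F t (t * u))" if "t \<in> {0..T}" for t
  \<comment> \<open>The substitution degenerates at t = 0, but there both sides vanish.\<close>
  proof (cases "t = 0")
    case False
    with that have "t > 0" by auto
    have "continuous_on {0..t} (\<lambda>\<tau>. case (t, \<tau>) of (t, \<tau>) \<Rightarrow> F t \<tau>)"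
      using that by (intro continuous_on_compose2 [OF F] continuous_intros) auto
    then have "(F t has_integral integral {0..t} (F t)) {0..t}"
      by (simp add: integrable_continuous_real integrable_integral)
    from has_integral_affinity' [of "F t" _ 0 t t 0] this \<open>t > 0\<close>
    have "((\<lambda>u. F t (t * u)) has_integral integral {0..t} (F t) / t) {0..1}"
      by (simp add: divide_inverse_commute)
    then show ?thesis using \<open>t > 0\<close> by (simp add: integral_unique)
  qed simp
  have "continuous_on ({0..T} \<times> cbox 0 1) (\<lambda>p. case (fst p, fst p * snd p) of (t, \<tau>) \<Rightarrow> F t \<tau>)"
    by (rule continuous_on_compose2 [OF F])
      (auto intro!: continuous_intros mult_left_le)
  then have "continuous_on {0..T} (\<lambda>t. integral (cbox 0 1) (\<lambda>u. F t (t * u)))"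
    by (intro integral_continuous_on_param) (simp add: case_prod_unfold)
  then have "continuous_on {0..T} (\<lambda>t. t * integral {0..1} (\<lambda>u. F t (t * u)))"
    by (auto intro!: continuous_intros)
  then show ?thesis
    by (rule continuous_on_eq) (simp add: eq)
qed

text \<open>Indefinite integrals are continuous for any integrable \<open>f\<close>, so this serves
  both \<mu> and the continuous intensities.\<close>

lemma continuous_on_integral_between:
  fixes f :: "real \<Rightarrow> real"
  assumes f: "f integrable_on {0..T}"
  shows "continuous_on {(t, \<tau>). 0 \<le> \<tau> \<and> \<tau> \<le> t \<and> t \<le> T} (\<lambda>(t, \<tau>). integral {\<tau>..t} f)"
proof -
  have I: "continuous_on {0..T} (\<lambda>x. integral {0..x} f)"
    using f by (rule indefinite_integral_continuous_1)
  have eq: "integral {\<tau>..t} f = integral {0..t} f - integral {0..\<tau>} f"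
    if "0 \<le> \<tau>" "\<tau> \<le> t" "t \<le> T" for t \<tau>
  proof -
    have "f integrable_on {0..t}"
      using f by (rule integrable_on_subinterval) (use that in auto)
    from Henstock_Kurzweil_Integration.integral_combine [OF _ _ this, of \<tau>] that
    show ?thesis by simp
  qed
  have "continuous_on {(t, \<tau>). 0 \<le> \<tau> \<and> \<tau> \<le> t \<and> t \<le> T}
      (\<lambda>p. integral {0..fst p} f - integral {0..snd p} f)"
    by (intro continuous_on_diff continuous_on_compose2 [OF I]) (auto intro!: continuous_intros)
  then show ?thesis
    by (rule continuous_on_eq) (auto intro: eq [symmetric])
qed

section \<open>The upper incomplete Gamma function\<close>

lemma integrable_upper_incomplete_Gamma:
  assumes "k \<ge> 1" "x \<ge> 0"
  shows "(\<lambda>s::real. s ^ (k - 1) * exp (- s)) integrable_on {x..}"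
proof -
  have "((\<lambda>s. s powr (real k - 1) / exp s) has_integral Gamma (real k)) {0..}"
    using assms by (intro Gamma_integral_real) simp
  then have "((\<lambda>s. s ^ (k - 1) * exp (- s)) has_integral Gamma (real k)) {0..}"
  \<comment> \<open>The point 0 is excluded because for k = 1 the integrands differ there:
    \<open>0 powr 0\<close> is 0, while \<open>0 ^ 0\<close> is 1.\<close>
  proof (rule has_integral_spike [of "{0}", rotated 2])
    fix s :: real assume "s \<in> {0..} - {0}"
    then have "s powr real (k - 1) = s ^ (k - 1)"
      by (intro powr_realpow) auto
    with \<open>k \<ge> 1\<close> show "s ^ (k - 1) * exp (- s) = s powr (real k - 1) / exp s"
      by (simp add: of_nat_diff exp_minus divide_inverse)
  qed simp
  then have "(\<lambda>s::real. s ^ (k - 1) * exp (- s)) integrable_on {0..}"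
    by (rule has_integral_integrable)
  \<comment> \<open>Nonnegativity upgrades integrability to absolute integrability, which passes to
    the unbounded subset \<open>{x..}\<close>.\<close>
  then have *: "(\<lambda>s::real. s ^ (k - 1) * exp (- s)) absolutely_integrable_on {0..}"
    by (rule nonnegative_absolutely_integrable_1) auto
  have "(\<lambda>s::real. s ^ (k - 1) * exp (- s)) absolutely_integrable_on {x..}"
    by (rule set_integrable_subset [OF *]) (use assms in auto)
  then show ?thesis by (rule set_lebesgue_integral_eq_integral)
qed

lemma upper_incomplete_Gamma_nonneg:
  assumes "x \<ge> 0"
  shows "upper_incomplete_Gamma k x \<ge> 0"
  unfolding upper_incomplete_Gamma_def
  \<comment> \<open>An integral that does not exist is 0 by convention, so the bound holds in either
    case.\<close>
  by (cases "(\<lambda>s. s ^ (k - 1) * exp (- s)) integrable_on {x..}")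
    (use assms in \<open>auto intro!: integral_nonneg simp: not_integrable_integral\<close>)

lemma upper_incomplete_Gamma_antimono:
  assumes "k \<ge> 1" "0 \<le> x" "x \<le> y"
  shows "upper_incomplete_Gamma k y \<le> upper_incomplete_Gamma k x"
  unfolding upper_incomplete_Gamma_def
  by (rule integral_subset_le) (use assms in \<open>auto intro!: integrable_upper_incomplete_Gamma
      simp del: One_nat_def\<close>)

text \<open>The improper integral is its value at 0 minus a proper integral with variable upper
  limit, and the latter is continuous.\<close>

lemma continuous_on_upper_incomplete_Gamma:
  assumes "k \<ge> 1"
  shows "continuous_on {0..B} (upper_incomplete_Gamma k)"
proof -
  let ?f = "\<lambda>s::real. s ^ (k - 1) * exp (- s)"
  have eq: "upper_incomplete_Gamma k x = upper_incomplete_Gamma k 0 - integral {0..x} ?f"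
    if "x \<in> {0..B}" for x
  proof -
    have "(?f has_integral integral {0..x} ?f + upper_incomplete_Gamma k x) ({0..x} \<union> {x..})"
    proof (rule has_integral_Un)
      show "(?f has_integral integral {0..x} ?f) {0..x}"
        by (intro integrable_integral integrable_continuous_real continuous_intros)
      show "(?f has_integral upper_incomplete_Gamma k x) {x..}"
        unfolding upper_incomplete_Gamma_def using assms that
        by (intro integrable_integral integrable_upper_incomplete_Gamma) auto
      have "{0..x} \<inter> {x..} = {x}" using that by auto
      then show "negligible ({0..x} \<inter> {x..})" by simp
    qed
    moreover have "{0..x} \<union> {x..} = {0..}" using that by auto
    ultimately show ?thesis
      unfolding upper_incomplete_Gamma_def [of k 0] by (simp add: integral_unique)
  qed
  have "continuous_on {0..B} (\<lambda>x. upper_incomplete_Gamma k 0 - integral {0..x} ?f)"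
    by (intro continuous_intros indefinite_integral_continuous_1 integrable_continuous_real)
  then show ?thesis
    by (rule continuous_on_eq) (rule eq [symmetric])
qed

section \<open>Joint continuity of the visibility integrand\<close>

lemma smooth_on_interval_imp_continuous_on:
  assumes "smooth_on_interval a b f"
  shows "continuous_on {a..b} f"
proof -
  obtain D :: "nat \<Rightarrow> real \<Rightarrow> real" where D0: "\<And>x. x \<in> {a..b} \<Longrightarrow> D 0 x = f x"
    and D: "\<And>n x. x \<in> {a..b} \<Longrightarrow> (D n has_real_derivative D (Suc n) x) (at x within {a..b})"
    using assms unfolding smooth_on_interval_def by metis
  have "continuous_on {a..b} (D 0)"
    using D by (rule DERIV_continuous_on)
  then show ?thesis using D0 by (rule continuous_on_eq)
qed

text \<open>Only integrals of \<mu> enter, so the integrand is continuous even where \<mu> is not.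
  This yields integrability in \<tau> for fixed t and, through
  \<open>continuous_on_integral_upto\<close>, in t.\<close>

lemma continuous_on_top_k_integrand:
  fixes \<mu> g :: "real \<Rightarrow> real"
  assumes \<mu>: "\<And>t. t \<in> {0..T} \<Longrightarrow> \<mu> t \<ge> 0" "\<mu> integrable_on {0..T}"
    and "k \<ge> 1" and g: "continuous_on {0..T} g"
  shows "continuous_on {(t, \<tau>). 0 \<le> \<tau> \<and> \<tau> \<le> t \<and> t \<le> T}
    (\<lambda>(t, \<tau>). g \<tau> * exp (- integral {\<tau>..t} g) * upper_incomplete_Gamma k (integral {\<tau>..t} \<mu>))"
proof -
  let ?S = "{(t, \<tau>). 0 \<le> \<tau> \<and> \<tau> \<le> t \<and> t \<le> T}"
  have "continuous_on ?S (\<lambda>p. g (snd p))"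
    by (rule continuous_on_compose2 [OF g continuous_on_snd [OF continuous_on_id]]) auto
  moreover have "continuous_on ?S (\<lambda>p. integral {snd p..fst p} g)"
    using continuous_on_integral_between [OF integrable_continuous_real [OF g]]
    by (simp add: case_prod_unfold)
  moreover have "continuous_on ?S
      (\<lambda>p. upper_incomplete_Gamma k (integral {snd p..fst p} \<mu>))"
  \<comment> \<open>Since \<mu> is nonnegative, its total integral bounds every argument fed to the
    Gamma function.\<close>
  proof (rule continuous_on_compose2
      [OF continuous_on_upper_incomplete_Gamma [OF \<open>k \<ge> 1\<close>, of "integral {0..T} \<mu>"]])
    show "continuous_on ?S (\<lambda>p. integral {snd p..fst p} \<mu>)"
      using continuous_on_integral_between [OF \<mu>(2)] by (simp add: case_prod_unfold)
    have "0 \<le> integral {\<tau>..t} \<mu> \<and> integral {\<tau>..t} \<mu> \<le> integral {0..T} \<mu>"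
      if "0 \<le> \<tau>" "\<tau> \<le> t" "t \<le> T" for t \<tau>
    proof -
      have "\<mu> integrable_on {\<tau>..t}"
        using \<mu>(2) by (rule integrable_on_subinterval) (use that in auto)
      with that \<mu> show ?thesis
        by (auto intro!: integral_nonneg integral_subset_le)
    qed
    then show "(\<lambda>p. integral {snd p..fst p} \<mu>) ` ?S \<subseteq> {0..integral {0..T} \<mu>}"
      by auto
  qed
  ultimately show ?thesis
    by (auto simp: case_prod_unfold intro!: continuous_intros)
qed

section \<open>Concavity, first at fixed time and then integrated over time\<close>

lemma top_k_prob_concave:
  assumes \<mu>: "\<And>t. t \<in> {0..T} \<Longrightarrow> \<mu> t \<ge> 0" "\<mu> integrable_on {0..T}"
    and "k \<ge> 1" and g1: "continuous_on {0..T} g1" and g2: "continuous_on {0..T} g2"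
    and \<alpha>: "0 < \<alpha>" "\<alpha> < 1" and t: "t \<in> {0..T}"
  shows "\<alpha> * top_k_prob \<mu> k g1 t + (1 - \<alpha>) * top_k_prob \<mu> k g2 t
    \<le> top_k_prob \<mu> k (\<lambda>x. \<alpha> * g1 x + (1 - \<alpha>) * g2 x) t"
proof -
  define g where "g = (\<lambda>x. \<alpha> * g1 x + (1 - \<alpha>) * g2 x)"
  define E where "E = (\<lambda>l \<tau>. l \<tau> * exp (- integral {\<tau>..t} l) :: real)"
  define G where "G = (\<lambda>\<tau>. upper_incomplete_Gamma k (integral {\<tau>..t} \<mu>))"
  \<comment> \<open>The concavity defect of the kernel \<open>E\<close>. It may change sign; only
    its tail integrals are controlled.\<close>
  define h where "h = (\<lambda>\<tau>. E g \<tau> - (\<alpha> * E g1 \<tau> + (1 - \<alpha>) * E g2 \<tau>))"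
  have g: "continuous_on {0..T} g"
    unfolding g_def using g1 g2 by (intro continuous_intros)
  have E: "(E l has_integral 1 - exp (- integral {c..t} l)) {c..t}"
    if "continuous_on {0..T} l" "c \<in> {0..t}" for l c
    unfolding E_def using that t
    by (intro has_integral_exp_neg_tail continuous_on_subset [OF that(1)]) auto
  have h: "(h has_integral (1 - exp (- integral {c..t} g))
      - (\<alpha> * (1 - exp (- integral {c..t} g1)) + (1 - \<alpha>) * (1 - exp (- integral {c..t} g2)))) {c..t}"
    if "c \<in> {0..t}" for c
    unfolding h_def using that g g1 g2
    by (intro has_integral_diff has_integral_add has_integral_mult_right E)
  have tail: "integral {c..t} h \<ge> 0" if c: "c \<in> {0..t}" for c
  proof -
    have "l integrable_on {c..t}" if "continuous_on {0..T} l" for l :: "real \<Rightarrow> real"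
      using c t by (intro integrable_continuous_real continuous_on_subset [OF that]) auto
    then have "integral {c..t} g = \<alpha> * integral {c..t} g1 + (1 - \<alpha>) * integral {c..t} g2"
      unfolding g_def using g1 g2
      by (subst integral_add) (auto intro!: integrable_on_mult_right)
    \<comment> \<open>The exponent is linear in the intensity, so convexity of \<open>exp\<close>
      decides the sign. The weights are written to fit \<open>convex_onD\<close> with parameter 1 -
      \<alpha>.\<close>
    then have "- integral {c..t} g
        = (1 - (1 - \<alpha>)) *\<^sub>R (- integral {c..t} g1) + (1 - \<alpha>) *\<^sub>R (- integral {c..t} g2)"
      by (simp add: algebra_simps)
    then have "exp (- integral {c..t} g)
        \<le> \<alpha> * exp (- integral {c..t} g1) + (1 - \<alpha>) * exp (- integral {c..t} g2)"
      using convex_onD [OF exp_convex, of "1 - \<alpha>" "- integral {c..t} g1" "- integral {c..t} g2"] \<alpha>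
      by simp
    then show ?thesis
      unfolding integral_unique [OF h [OF c]] by (simp add: algebra_simps)
  qed
  have sub: "\<mu> integrable_on {\<tau>..t}" if "0 \<le> \<tau>" for \<tau>
    using \<mu>(2) by (rule integrable_on_subinterval) (use that t in auto)
  have "integral {0..t} (\<lambda>\<tau>. G \<tau> * h \<tau>) \<ge> 0"
  proof (rule integral_mono_weight_nonneg)
    show "h integrable_on {0..t}"
      using h[of 0] t by (auto simp: has_integral_integrable)
    \<comment> \<open>Raising the lower limit shrinks the integral of \<mu>, and the Gamma function
      is antitone.\<close>
    show "G x \<le> G y" if "0 \<le> x" "x \<le> y" "y \<le> t" for x y
      unfolding G_def using that t \<mu>(1) sub \<open>k \<ge> 1\<close>
      by (intro upper_incomplete_Gamma_antimono integral_nonneg integral_subset_le) auto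
    show "G 0 \<ge> 0"
      unfolding G_def using t \<mu>(1) sub
      by (intro upper_incomplete_Gamma_nonneg integral_nonneg) auto
  qed (use t tail in auto)
  moreover have int: "(\<lambda>\<tau>. E l \<tau> * G \<tau>) integrable_on {0..t}" if "continuous_on {0..T} l" for l
  proof -
    have "continuous_on {0..t} (\<lambda>\<tau>. case (t, \<tau>) of (t, \<tau>) \<Rightarrow>
        l \<tau> * exp (- integral {\<tau>..t} l) * upper_incomplete_Gamma k (integral {\<tau>..t} \<mu>))"
      using t by (intro continuous_on_compose2
          [OF continuous_on_top_k_integrand [OF \<mu> \<open>k \<ge> 1\<close> that]] continuous_intros) auto
    then show ?thesis
      unfolding E_def G_def by (intro integrable_continuous_real) simp
  qed
  have "integral {0..t} (\<lambda>\<tau>. G \<tau> * h \<tau>) = integral {0..t} (\<lambda>\<tau>. E g \<tau> * G \<tau>)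
      - (\<alpha> * integral {0..t} (\<lambda>\<tau>. E g1 \<tau> * G \<tau>) + (1 - \<alpha>) * integral {0..t} (\<lambda>\<tau>. E g2 \<tau> * G \<tau>))"
  proof (rule integral_unique)
    have "((\<lambda>\<tau>. E g \<tau> * G \<tau> - (\<alpha> * (E g1 \<tau> * G \<tau>) + (1 - \<alpha>) * (E g2 \<tau> * G \<tau>))) has_integral
      integral {0..t} (\<lambda>\<tau>. E g \<tau> * G \<tau>) - (\<alpha> * integral {0..t} (\<lambda>\<tau>. E g1 \<tau> * G \<tau>)
        + (1 - \<alpha>) * integral {0..t} (\<lambda>\<tau>. E g2 \<tau> * G \<tau>))) {0..t}"
      by (intro has_integral_diff has_integral_add has_integral_mult_right integrable_integral
          int g g1 g2)
    then show "((\<lambda>\<tau>. G \<tau> * h \<tau>) has_integral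
      integral {0..t} (\<lambda>\<tau>. E g \<tau> * G \<tau>) - (\<alpha> * integral {0..t} (\<lambda>\<tau>. E g1 \<tau> * G \<tau>)
        + (1 - \<alpha>) * integral {0..t} (\<lambda>\<tau>. E g2 \<tau> * G \<tau>))) {0..t}"
      by (rule has_integral_eq [rotated]) (simp add: h_def algebra_simps)
  qed
  ultimately have "\<alpha> * integral {0..t} (\<lambda>\<tau>. E g1 \<tau> * G \<tau>) + (1 - \<alpha>) * integral {0..t} (\<lambda>\<tau>. E g2 \<tau> * G \<tau>)
      \<le> integral {0..t} (\<lambda>\<tau>. E g \<tau> * G \<tau>)"
    by linarith
  then have "1 / fact (k - 1) * (\<alpha> * integral {0..t} (\<lambda>\<tau>. E g1 \<tau> * G \<tau>)
      + (1 - \<alpha>) * integral {0..t} (\<lambda>\<tau>. E g2 \<tau> * G \<tau>))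
      \<le> 1 / fact (k - 1) * integral {0..t} (\<lambda>\<tau>. E g \<tau> * G \<tau>)"
    by (intro mult_left_mono) auto
  moreover have "top_k_prob \<mu> k l t = 1 / fact (k - 1) * integral {0..t} (\<lambda>\<tau>. E l \<tau> * G \<tau>)" for l
    by (simp add: top_k_prob_def E_def G_def)
  ultimately show ?thesis
    unfolding g_def [symmetric] by (simp only: distrib_left mult.left_commute)
qed

text \<open>Integrability in t licenses integrating the pointwise inequality; it comes from
  continuity in t.\<close>

lemma top_k_prob_integrable:
  assumes "\<And>t. t \<in> {0..T} \<Longrightarrow> \<mu> t \<ge> 0" "\<mu> integrable_on {0..T}" "k \<ge> 1" "continuous_on {0..T} g"
  shows "top_k_prob \<mu> k g integrable_on {0..T}"
  unfolding top_k_prob_def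
  by (intro integrable_continuous_real continuous_intros continuous_on_integral_upto
      continuous_on_top_k_integrand assms)

theorem theorem4:
  fixes T :: real and \<mu> :: "real \<Rightarrow> real" and k :: nat
  assumes "T > 0"
    and "\<And>t. t \<in> {0..T} \<Longrightarrow> \<mu> t \<ge> 0"
    and "\<mu> absolutely_integrable_on {0..T}"
    and "k \<ge> 1"
  shows "concave_functional_on (smooth_space T) (visibility \<mu> T k)"
proof -
  have \<mu>: "\<mu> integrable_on {0..T}"
    using assms(3) by (rule set_lebesgue_integral_eq_integral)
  \<comment> \<open>The inequality is shown for all continuous intensities, among which are the
    smooth ones.\<close>
  have "\<alpha> * visibility \<mu> T k g1 + (1 - \<alpha>) * visibility \<mu> T k g2
      \<le> visibility \<mu> T k (\<lambda>x. \<alpha> * g1 x + (1 - \<alpha>) * g2 x)"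
    if g1: "continuous_on {0..T} g1" and g2: "continuous_on {0..T} g2" and \<alpha>: "0 < \<alpha>" "\<alpha> < 1"
    for g1 g2 \<alpha>
  proof (rule has_integral_le)
    show "((\<lambda>t. \<alpha> * top_k_prob \<mu> k g1 t + (1 - \<alpha>) * top_k_prob \<mu> k g2 t) has_integral
        \<alpha> * visibility \<mu> T k g1 + (1 - \<alpha>) * visibility \<mu> T k g2) {0..T}"
      unfolding visibility_def
      by (intro has_integral_add has_integral_mult_right integrable_integral
          top_k_prob_integrable assms(2,4) \<mu> g1 g2)
    show "(top_k_prob \<mu> k (\<lambda>x. \<alpha> * g1 x + (1 - \<alpha>) * g2 x) has_integral
        visibility \<mu> T k (\<lambda>x. \<alpha> * g1 x + (1 - \<alpha>) * g2 x)) {0..T}"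
      unfolding visibility_def
      by (intro integrable_integral top_k_prob_integrable assms(2,4) \<mu> continuous_intros g1 g2)
  qed (rule top_k_prob_concave [OF assms(2) \<mu> assms(4) g1 g2 \<alpha>])
  then show ?thesis
    unfolding concave_functional_on_def smooth_space_def
    using smooth_on_interval_imp_continuous_on by auto
qed

end
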